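(* Let $n,m\ge 0$ and let $A\subseteq Y_n$, $B\subseteq Y_m$ be groves. Then the sets $a+b$, for $(a,b)\in A\times B$, are pairwise disjoint subsets of $Y_{n+m}$. Consequently $A+B$ is again a grove (each tree occurs in it at most once), and addition defines a map $+:\mathbb{Y}_n\times\mathbb{Y}_m\to\mathbb{Y}_{n+m}$.
   Context: A planar binary tree of degree $n\ge 0$ is a planar rooted tree (up to planar isotopy) with $n+1$ leaves in which every internal vertex has exactly two inputs; $Y_n$ is the set of these trees. $Y_0=\{|\}$ (the single edge, also denoted $0$). For $x\in Y_p$, $y\in Y_q$ the grafting $x\vee y\in Y_{p+q+1}$ joins the roots of $x$ and $y$ to a new vertex with a new root; every $x\in Y_n$, $n\ge1$, decomposes uniquely as $x=x^l\vee x^r$. Each $Y_n$ carries the (Tamari) partial order: the smallest partial order such that $(a\vee b)\vee c\le a\vee(b\vee c)$ for all trees $a,b,c$, and $a\le b$ implies $a\vee c\le b\vee c$ and $c\vee a\le c\vee b$. For $x\in Y_p,y\in Y_q$, the tree $x/y\in Y_{p+q}$ ("over") is obtained by identifying the root of $x$ with the leftmost leaf of $y$, and $x\backslash y\in Y_{p+q}$ ("under") by identifying the rightmost leaf of $x$ with the root of $y$ (recursively: $x/|=x$, $x/(y^l\vee y^r)=(x/y^l)\vee y^r$, $|\backslash y=y$, $(x^l\vee x^r)\backslash y=x^l\vee(x^r\backslash y)$). The sum of trees is $x+y:=\{z\in Y_{p+q}: x/y\le z\le x\backslash y\}$. A grove of degree $n$ is a nonempty subset of $Y_n$; $\mathbb{Y}_n$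 denotes the set of groves of degree $n$. For groves $A,B$ (a tree being identified with a one-element grove), $A+B$ is defined as the union of the sets $a+b$, $a\in A$, $b\in B$, a priori counted with multiplicity (multiset union). *)

theory Defs
  imports "HOL-Library.Multiset" "HOL-Library.FuncSet" "HOL-Library.Disjoint_Sets"
begin

text \<open>Planar binary trees: \<open>Edge\<close> is the tree \<open>|\<close>, and \<open>Graft x y\<close> is the grafting of
  \<open>x\<close> (left) and \<open>y\<close> (right).\<close>

datatype ptree = Edge | Graft ptree ptree

primrec leaves :: "ptree \<Rightarrow> nat" where
  "leaves Edge = 1"
| "leaves (Graft x y) = leaves x + leaves y"

lemma leaves_pos [simp]: "0 < leaves x"
  by (induction x) auto

definition Y :: "nat \<Rightarrow> ptree set" where
  "Y n = {x. leaves x = n + 1}"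

definition degree :: "ptree \<Rightarrow> nat" where
  "degree x = leaves x - 1"

lemma in_Y_iff: "x \<in> Y n \<longleftrightarrow> degree x = n"
  using leaves_pos[of x] by (auto simp: Y_def degree_def simp del: leaves_pos)

text \<open>\<open>tamari\<close> is the least reflexive and transitive relation with the two required closure
  properties. It relates only trees of equal degree and turns out to be antisymmetric, hence it
  is the smallest such partial order, on all the \<open>Y n\<close> simultaneously.\<close>

inductive tamari :: "ptree \<Rightarrow> ptree \<Rightarrow> bool" where
  tamari_refl: "tamari x x"
| tamari_trans: "tamari x y \<Longrightarrow> tamari y z \<Longrightarrow> tamari x z"
| tamari_assoc: "tamari (Graft (Graft a b) c) (Graft a (Graft b c))"
| tamari_left: "tamari a b \<Longrightarrow> tamari (Graft a c) (Graft b c)"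
| tamari_right: "tamari a b \<Longrightarrow> tamari (Graft c a) (Graft c b)"

lemma tamari_leaves: "tamari x y \<Longrightarrow> leaves x = leaves y"
  by (induction rule: tamari.induct) auto

text \<open>A statistic strictly increasing along the Tamari order, used for antisymmetry.\<close>

primrec tamari_weight :: "ptree \<Rightarrow> nat" where
  "tamari_weight Edge = 0"
| "tamari_weight (Graft x y) = tamari_weight x + tamari_weight y + leaves y"

lemma tamari_weight_less: "tamari x y \<Longrightarrow> x = y \<or> tamari_weight x < tamari_weight y"
  by (induction rule: tamari.induct) (auto dest: tamari_leaves)

instantiation ptree :: order
begin

definition less_eq_ptree :: "ptree \<Rightarrow> ptree \<Rightarrow> bool" where
  "x \<le> y \<longleftrightarrow> tamari x y"

definition less_ptree :: "ptree \<Rightarrow> ptree \<Rightarrow> bool" where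
  "x < y \<longleftrightarrow> x \<le> y \<and> \<not> y \<le> (x :: ptree)"

instance
proof
  fix x y z :: ptree
  show "x < y \<longleftrightarrow> x \<le> y \<and> \<not> y \<le> x"
    by (rule less_ptree_def)
  show "x \<le> x"
    by (simp add: less_eq_ptree_def tamari_refl)
  show "x \<le> z" if "x \<le> y" "y \<le> z"
    using that unfolding less_eq_ptree_def by (rule tamari_trans)
  show "x = y" if "x \<le> y" "y \<le> x"
    using that tamari_weight_less[of x y] tamari_weight_less[of y x]
    by (auto simp: less_eq_ptree_def)
qed

end

text \<open>\<open>over x y\<close> is \<open>x / y\<close>, and \<open>under x y\<close> is \<open>x \ y\<close>.\<close>

primrec over :: "ptree \<Rightarrow> ptree \<Rightarrow> ptree" where
  "over x Edge = x"
| "over x (Graft l r) = Graft (over x l) r"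

primrec under :: "ptree \<Rightarrow> ptree \<Rightarrow> ptree" where
  "under Edge y = y"
| "under (Graft l r) y = Graft l (under r y)"

definition tree_sum :: "ptree \<Rightarrow> ptree \<Rightarrow> ptree set" where
  "tree_sum x y = {z \<in> Y (degree x + degree y). over x y \<le> z \<and> z \<le> under x y}"

definition groves :: "nat \<Rightarrow> ptree set set" where
  "groves n = {A. A \<noteq> {} \<and> A \<subseteq> Y n}"

text \<open>Finiteness of \<open>Y n\<close> ensures that the finite sums and the \<open>mset_set\<close> in \<open>grove_sum\<close> below
  do not take their default values.\<close>

lemma finite_leaves_le: "finite {x. leaves x \<le> k}"
proof (induction k)
  case 0
  have "{x. leaves x \<le> 0} = {}"
    using leaves_pos by (auto simp: not_le simp del: le_zero_eq)
  then show ?case by (simp only: finite.emptyI)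
next
  case (Suc k)
  let ?S = "{x. leaves x \<le> k}"
  have "{x. leaves x \<le> Suc k} \<subseteq> insert Edge ((\<lambda>(x, y). Graft x y) ` (?S \<times> ?S))"
  proof
    fix x assume x: "x \<in> {x. leaves x \<le> Suc k}"
    show "x \<in> insert Edge ((\<lambda>(x, y). Graft x y) ` (?S \<times> ?S))"
    proof (cases x)
      case (Graft l r)
      then have "leaves l \<le> k" "leaves r \<le> k"
        using x leaves_pos[of l] leaves_pos[of r] by (auto simp del: leaves_pos)
      then show ?thesis
        using Graft by auto
    qed simp
  qed
  then show ?case
    by (rule finite_subset) (use Suc in auto)
qed

lemma finite_Y: "finite (Y n)"
  by (rule finite_subset[OF _ finite_leaves_le[of "n + 1"]]) (auto simp: Y_def)

lemma finite_tree_sum: "finite (tree_sum x y)"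
  by (rule finite_subset[OF _ finite_Y]) (auto simp: tree_sum_def)

lemma finite_grove: "A \<in> groves n \<Longrightarrow> finite A"
  by (auto simp: groves_def intro: finite_subset[OF _ finite_Y])

text \<open>The sum of groves is the multiset union of the sums of their elements, so that a
  tree is counted once for each pair \<open>(a, b)\<close> whose sum contains it.\<close>

definition grove_sum :: "ptree set \<Rightarrow> ptree set \<Rightarrow> ptree multiset" where
  "grove_sum A B = (\<Sum>(a, b)\<in>A \<times> B. mset_set (tree_sum a b))"

end

theory Submission
  imports Defs
begin

text \<open>If \<open>x / y \<le> z \<le> x \ y\<close>, then \<open>x\<close> and \<open>y\<close> can be recovered from \<open>z\<close> and the degree of \<open>x\<close>:
  restricting a tree to its first \<open>k\<close> leaves (deleting the others and contracting) is monotone for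
  the Tamari order, and for \<open>k = leaves x\<close> it maps both \<open>x / y\<close> and \<open>x \ y\<close> to \<open>x\<close>, hence also
  \<open>z\<close>, by antisymmetry. The symmetric restriction to the last leaves yields \<open>y\<close>.\<close>

text \<open>At least one leaf is always kept: \<open>first_leaves\<close> treats \<open>k = 0\<close> like \<open>k = 1\<close>, and
  \<open>drop_leaves\<close> stops at the last leaf.\<close>

primrec first_leaves :: "nat \<Rightarrow> ptree \<Rightarrow> ptree" where
  "first_leaves k Edge = Edge"
| "first_leaves k (Graft l r) =
    (if k \<le> leaves l then first_leaves k l else Graft l (first_leaves (k - leaves l) r))"

primrec drop_leaves :: "nat \<Rightarrow> ptree \<Rightarrow> ptree" where
  "drop_leaves k Edge = Edge"
| "drop_leaves k (Graft l r) =
    (if k < leaves l then Graft (drop_leaves k l) r else drop_leaves (k - leaves l) r)"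

lemma Graft_mono_left: "a \<le> b \<Longrightarrow> Graft a c \<le> Graft b c"
  by (simp add: less_eq_ptree_def tamari_left)

lemma Graft_mono_right: "a \<le> b \<Longrightarrow> Graft c a \<le> Graft c b"
  by (simp add: less_eq_ptree_def tamari_right)

lemma Graft_assoc_le: "Graft (Graft a b) c \<le> Graft a (Graft b c)"
  by (simp add: less_eq_ptree_def tamari_assoc)

lemma le_imp_leaves_eq: "x \<le> y \<Longrightarrow> leaves x = leaves y"
  by (simp add: less_eq_ptree_def tamari_leaves)

text \<open>The order preserves leaf counts, so the cut falls in corresponding subtrees on both
  sides. The two sides of a rotation restrict to the same tree unless the cut reaches
  \<open>c\<close>, and then a rotation remains. \<open>k\<close> is generalized because it is
  shifted in right subtrees.\<close>

lemma first_leaves_mono: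
  assumes "x \<le> y"
  shows "first_leaves k x \<le> first_leaves k y"
proof -
  have "tamari x y" using assms by (simp add: less_eq_ptree_def)
  then show ?thesis
  proof (induction arbitrary: k rule: tamari.induct)
    case (tamari_trans x y z)
    then show ?case by (meson order_trans)
  next
    case (tamari_left a b c)
    then have "a \<le> b" "leaves a = leaves b"
      by (simp_all add: less_eq_ptree_def tamari_leaves)
    then show ?case using tamari_left.IH by (simp add: Graft_mono_left)
  qed (auto simp: less_eq_ptree_def[symmetric] Graft_assoc_le Graft_mono_left Graft_mono_right
        dest: le_imp_leaves_eq)
qed

text \<open>Mirror image of \<open>first_leaves_mono\<close>: here a rotation remains only if the
  cut falls inside \<open>a\<close>.\<close>

lemma drop_leaves_mono:
  assumes "x \<le> y"
  shows "drop_leaves k x \<le> drop_leaves k y"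
proof -
  have "tamari x y" using assms by (simp add: less_eq_ptree_def)
  then show ?thesis
  proof (induction arbitrary: k rule: tamari.induct)
    case (tamari_trans x y z)
    then show ?case by (meson order_trans)
  qed (auto simp: less_eq_ptree_def[symmetric] Graft_assoc_le Graft_mono_left Graft_mono_right
        dest: le_imp_leaves_eq)
qed

lemma leaves_over: "leaves (over x y) = leaves x + leaves y - 1"
proof (induction y)
  case (Graft l r)
  then show ?case using leaves_pos[of l] by (simp del: leaves_pos)
qed simp

lemma first_leaves_all: "leaves x \<le> k \<Longrightarrow> first_leaves k x = x"
proof (induction x arbitrary: k)
  case (Graft l r)
  then show ?case using leaves_pos[of r] by (auto simp del: leaves_pos)
qed simp

lemma first_leaves_1: "first_leaves (Suc 0) x = Edge"
  by (induction x) (auto simp: Suc_le_eq)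

lemma drop_leaves_0: "drop_leaves 0 x = x"
  by (induction x) auto

lemma drop_leaves_all: "leaves x - 1 \<le> k \<Longrightarrow> drop_leaves k x = Edge"
proof (induction x arbitrary: k)
  case (Graft l r)
  then show ?case using leaves_pos[of l] leaves_pos[of r] by (auto simp del: leaves_pos)
qed simp

text \<open>At every vertex of the left spine of \<open>y\<close> the left subtree contains all of
  \<open>x\<close>, so the cut descends until only \<open>x\<close> is left.\<close>

lemma first_leaves_over: "first_leaves (leaves x) (over x y) = x"
proof (induction y)
  case (Graft l r)
  then show ?case using leaves_pos[of l] by (auto simp: leaves_over simp del: leaves_pos)
qed (simp add: first_leaves_all)

text \<open>The last leaf of \<open>x\<close> carries \<open>y\<close>, so the cut retains exactly
  one leaf of \<open>y\<close>, which collapses \<open>y\<close> to \<open>Edge\<close>.\<close>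

lemma first_leaves_under: "first_leaves (leaves x) (under x y) = x"
proof (induction x)
  case (Graft l r)
  then show ?case using leaves_pos[of r] by (simp del: leaves_pos)
qed (simp add: first_leaves_1)

text \<open>Only \<open>leaves x - 1\<close> leaves are dropped: the last leaf of \<open>x\<close>
  survives as the leftmost leaf of \<open>y\<close>.\<close>

lemma drop_leaves_over: "drop_leaves (leaves x - 1) (over x y) = y"
proof (induction y)
  case (Graft l r)
  then show ?case
    using leaves_pos[of l] leaves_pos[of x] by (auto simp: leaves_over simp del: leaves_pos)
qed (simp add: drop_leaves_all)

lemma drop_leaves_under: "drop_leaves (leaves x - 1) (under x y) = y"
proof (induction x)
  case (Graft l r)
  \<comment> \<open>As \<open>leaves r\<close> is positive, the cut lies past all of
    \<open>l\<close>, and the shifted cut is that of the induction hypothesis.\<close>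
  have "\<not> leaves l + leaves r - 1 < leaves l"
    "leaves l + leaves r - 1 - leaves l = leaves r - 1"
    using leaves_pos[of r] by (auto simp del: leaves_pos)
  then show ?case using Graft by simp
qed (simp add: drop_leaves_0)

lemma first_leaves_tree_sum:
  assumes "z \<in> tree_sum x y"
  shows "first_leaves (leaves x) z = x"
  using assms first_leaves_mono[of "over x y" z "leaves x"]
    first_leaves_mono[of z "under x y" "leaves x"]
  by (auto simp: tree_sum_def first_leaves_over first_leaves_under)

lemma drop_leaves_tree_sum:
  assumes "z \<in> tree_sum x y"
  shows "drop_leaves (leaves x - 1) z = y"
proof (rule antisym)
  show "drop_leaves (leaves x - 1) z \<le> y"
    using assms drop_leaves_mono[of z "under x y" "leaves x - 1"]
    by (simp only: tree_sum_def drop_leaves_under mem_Collect_eq)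
  show "y \<le> drop_leaves (leaves x - 1) z"
    using assms drop_leaves_mono[of "over x y" z "leaves x - 1"]
    by (simp only: tree_sum_def drop_leaves_over mem_Collect_eq)
qed

text \<open>One rotation for each vertex on the right spine of \<open>x\<close> moves
  \<open>x\<close> out of the left subtree to the top.\<close>

lemma Graft_under_le: "Graft (under x l) r \<le> under x (Graft l r)"
proof (induction x)
  case (Graft a b)
  have "Graft (Graft a (under b l)) r \<le> Graft a (Graft (under b l) r)"
    by (rule Graft_assoc_le)
  also have "\<dots> \<le> Graft a (under b (Graft l r))"
    by (rule Graft_mono_right) (rule Graft)
  finally show ?case by simp
qed simp

lemma under_Edge: "under x Edge = x"
  by (induction x) auto

text \<open>This makes the interval defining a sum of trees nonempty.\<close>

lemma over_le_under: "over x y \<le> under x y"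
proof (induction y)
  case (Graft l r)
  have "Graft (over x l) r \<le> Graft (under x l) r"
    by (rule Graft_mono_left) (rule Graft)
  also have "\<dots> \<le> under x (Graft l r)"
    by (rule Graft_under_le)
  finally show ?case by simp
qed (simp add: under_Edge)

lemma over_in_tree_sum: "over x y \<in> tree_sum x y"
proof -
  have "degree (over x y) = degree x + degree y"
    using leaves_pos[of x] leaves_pos[of y] by (simp add: degree_def leaves_over del: leaves_pos)
  then show ?thesis by (simp add: tree_sum_def in_Y_iff over_le_under)
qed

lemma tree_sum_disjoint:
  assumes "A \<subseteq> Y n"
  shows "disjoint_family_on (\<lambda>(a, b). tree_sum a b) (A \<times> B)"
proof -
  have "a = c \<and> b = d"
    if "a \<in> A" "c \<in> A" and in_sums: "z \<in> tree_sum a b" "z \<in> tree_sum c d" for a b c d z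
  proof -
    have "a \<in> Y n" "c \<in> Y n"
      using assms \<open>a \<in> A\<close> \<open>c \<in> A\<close> by blast+
    \<comment> \<open>Equal degrees in \<open>A\<close> make one cut position serve both pairs, so
      \<open>z\<close> determines the pair.\<close>
    then have "leaves a = leaves c"
      by (simp add: Y_def)
    then show ?thesis
      using in_sums by (metis first_leaves_tree_sum drop_leaves_tree_sum)
  qed
  then show ?thesis
    unfolding disjoint_family_on_def by fastforce
qed

text \<open>The multiplicity of \<open>t\<close> is the number of indices whose set contains it.
  Finiteness of the sets matters because \<open>mset_set\<close> of an infinite set is
  empty.\<close>

lemma count_sum_mset_set_le_1:
  assumes "finite I" and fin: "\<And>i. i \<in> I \<Longrightarrow> finite (F i)" and "disjoint_family_on F I"
  shows "count (\<Sum>i\<in>I. mset_set (F i)) t \<le> 1"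
proof -
  have "count (\<Sum>i\<in>I. mset_set (F i)) t = (\<Sum>i\<in>I. if t \<in> F i then 1 else 0)"
    unfolding count_sum by (rule sum.cong) (use fin in \<open>auto simp: count_mset_set'\<close>)
  also have "\<dots> = card {i \<in> I. t \<in> F i}"
    using \<open>finite I\<close> by (simp add: sum.If_cases Int_def)
  also have "\<dots> \<le> 1"
    using assms(1,3) by (auto simp: card_le_Suc0_iff_eq disjoint_family_on_def)
  finally show ?thesis .
qed

lemma set_mset_grove_sum:
  assumes "finite A" "finite B"
  shows "set_mset (grove_sum A B) = (\<Union>a\<in>A. \<Union>b\<in>B. tree_sum a b)"
  using assms by (fastforce simp: grove_sum_def set_mset_sum finite_tree_sum)

lemma tree_sum_subset_Y: "a \<in> Y n \<Longrightarrow> b \<in> Y m \<Longrightarrow> tree_sum a b \<subseteq> Y (n + m)"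
  by (auto simp: tree_sum_def in_Y_iff)

lemma grove_sum_in_groves:
  assumes "A \<in> groves n" "B \<in> groves m"
  shows "set_mset (grove_sum A B) \<in> groves (n + m)"
proof -
  have "set_mset (grove_sum A B) = (\<Union>a\<in>A. \<Union>b\<in>B. tree_sum a b)"
    using assms by (simp add: set_mset_grove_sum finite_grove)
  \<comment> \<open>Any such pair gives the witness \<open>over a b\<close> for nonemptiness of the
    union.\<close>
  moreover obtain a b where "a \<in> A" "b \<in> B"
    using assms by (auto simp: groves_def)
  moreover have "over a b \<in> tree_sum a b"
    by (rule over_in_tree_sum)
  moreover have "tree_sum a b \<subseteq> Y (n + m)" if "a \<in> A" "b \<in> B" for a b
    using that assms by (intro tree_sum_subset_Y) (auto simp: groves_def)
  ultimately show ?thesis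
    unfolding groves_def by blast
qed

lemma count_grove_sum_le_1:
  assumes "A \<in> groves n" "B \<in> groves m"
  shows "count (grove_sum A B) t \<le> 1"
proof -
  have "finite (A \<times> B)"
    using assms by (simp add: finite_grove)
  moreover have "disjoint_family_on (\<lambda>(a, b). tree_sum a b) (A \<times> B)"
    using assms by (intro tree_sum_disjoint[of _ n]) (simp add: groves_def)
  \<comment> \<open>The case distinction on \<open>p\<close> stands inside \<open>mset_set\<close>
    to match the form \<open>mset_set (F i)\<close>.\<close>
  ultimately have "count (\<Sum>p\<in>A \<times> B. mset_set (case p of (a, b) \<Rightarrow> tree_sum a b)) t \<le> 1"
    by (intro count_sum_mset_set_le_1) (auto simp: finite_tree_sum)
  then show ?thesis
    by (simp add: grove_sum_def case_prod_unfold)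
qed

theorem theorem2p2:
  fixes n m :: nat
  shows "(\<forall>A\<in>groves n. \<forall>B\<in>groves m.
            (\<forall>a\<in>A. \<forall>b\<in>B. tree_sum a b \<subseteq> Y (n + m)) \<and>
            disjoint_family_on (\<lambda>(a, b). tree_sum a b) (A \<times> B) \<and>
            (\<forall>t. count (grove_sum A B) t \<le> 1) \<and>
            set_mset (grove_sum A B) \<in> groves (n + m)) \<and>
         (\<lambda>(A, B). set_mset (grove_sum A B)) \<in> groves n \<times> groves m \<rightarrow> groves (n + m)"
proof (intro conjI ballI allI)
  fix A B assume AB: "A \<in> groves n" "B \<in> groves m"
  show "tree_sum a b \<subseteq> Y (n + m)" if "a \<in> A" "b \<in> B" for a b
    using that AB by (intro tree_sum_subset_Y) (auto simp: groves_def)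
  show "disjoint_family_on (\<lambda>(a, b). tree_sum a b) (A \<times> B)"
    using AB by (intro tree_sum_disjoint[of _ n]) (simp add: groves_def)
  show "count (grove_sum A B) t \<le> 1" for t
    using AB by (rule count_grove_sum_le_1)
  show "set_mset (grove_sum A B) \<in> groves (n + m)"
    using AB by (rule grove_sum_in_groves)
next
  show "(\<lambda>(A, B). set_mset (grove_sum A B)) \<in> groves n \<times> groves m \<rightarrow> groves (n + m)"
    using grove_sum_in_groves by auto
qed

end
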